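(* Let $D$ be a parallelogram in the $xy$ plane and let $E_I$ denote the unique ellipse of minimal eccentricity inscribed in $D$. Then the smallest nonnegative angle between equal conjugate diameters of $E_I$ equals the smallest nonnegative angle between the diagonals of $D$.
   Context: Parallelograms are nondegenerate. An ellipse (circles are allowed) is inscribed in a parallelogram $D$ if it lies in $D$ and is tangent to each of the four sides of $D$. If $a\ge b>0$ are the lengths of the semi-major and semi-minor axes of an ellipse, its eccentricity is $\sqrt{1-b^2/a^2}$ (so a circle has eccentricity $0$). For every parallelogram $D$ there is exactly one inscribed ellipse whose eccentricity is minimal among all ellipses inscribed in $D$; it is denoted $E_I$. A diameter of an ellipse is a chord through its center; two diameters are conjugate if each one bisects all chords parallel to the other. Equal conjugate diameters are a pair of conjugate diameters having the same length; for a non-circular ellipse this pair is unique, and for a circle any pair of conjugate (i.e. perpendicular) diameters is such a pair. The smallest nonnegative angle between two segments is the angle in $[0,\pi/2]$ between the lines containing them. *)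

theory Defs
  imports "HOL-Analysis.Analysis"
begin

definition parallelogram :: "real^2 \<Rightarrow> real^2 \<Rightarrow> real^2 \<Rightarrow> real^2 \<Rightarrow> bool" where
  "parallelogram A B C D \<longleftrightarrow> B - A = C - D \<and> \<not> collinear {A, B, C}"

definition ellipse_point ::
  "real^2 \<Rightarrow> real^2 \<Rightarrow> real^2 \<Rightarrow> real \<Rightarrow> real \<Rightarrow> real \<Rightarrow> real^2" where
  "ellipse_point c e f a b t = c + (a * cos t) *\<^sub>R e + (b * sin t) *\<^sub>R f"

text \<open>An ellipse is the curve, not the region it bounds. The unit vectors \<open>e\<close> and \<open>f\<close> span the
  major and the minor axis.\<close>

definition ellipse_with ::
  "real^2 \<Rightarrow> real^2 \<Rightarrow> real^2 \<Rightarrow> real \<Rightarrow> real \<Rightarrow> (real^2) set \<Rightarrow> bool" where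
  "ellipse_with c e f a b E \<longleftrightarrow>
     norm e = 1 \<and> norm f = 1 \<and> e \<bullet> f = 0 \<and> 0 < b \<and> b \<le> a \<and> E = range (ellipse_point c e f a b)"

definition ellipse :: "(real^2) set \<Rightarrow> bool" where
  "ellipse E \<longleftrightarrow> (\<exists>c e f a b. ellipse_with c e f a b E)"

text \<open>Both descriptions below are proper: see \<open>ellipse_center_eq\<close> and \<open>eccentricity_eq\<close>.\<close>

definition ellipse_center :: "(real^2) set \<Rightarrow> real^2" where
  "ellipse_center E = (THE c. \<exists>e f a b. ellipse_with c e f a b E)"

definition eccentricity :: "(real^2) set \<Rightarrow> real" where
  "eccentricity E = (THE \<epsilon>. \<exists>c e f a b. ellipse_with c e f a b E \<and> \<epsilon> = sqrt (1 - b\<^sup>2 / a\<^sup>2))"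

definition tangent_to_segment :: "(real^2) set \<Rightarrow> real^2 \<Rightarrow> real^2 \<Rightarrow> bool" where
  "tangent_to_segment E p q \<longleftrightarrow>
     (\<exists>c e f a b t. ellipse_with c e f a b E \<and> ellipse_point c e f a b t \<in> closed_segment p q \<and>
        (\<exists>k. vector_derivative (ellipse_point c e f a b) (at t) = k *\<^sub>R (q - p)))"

definition inscribed_ellipse ::
  "real^2 \<Rightarrow> real^2 \<Rightarrow> real^2 \<Rightarrow> real^2 \<Rightarrow> (real^2) set \<Rightarrow> bool" where
  "inscribed_ellipse A B C D E \<longleftrightarrow>
     ellipse E \<and> E \<subseteq> convex hull {A, B, C, D} \<and>
     tangent_to_segment E A B \<and> tangent_to_segment E B C \<and>
     tangent_to_segment E C D \<and> tangent_to_segment E D A"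

definition min_ecc_ellipse ::
  "real^2 \<Rightarrow> real^2 \<Rightarrow> real^2 \<Rightarrow> real^2 \<Rightarrow> (real^2) set" where
  "min_ecc_ellipse A B C D = (THE E. is_arg_min eccentricity (inscribed_ellipse A B C D) E)"

text \<open>Chords and diameters are given by their two endpoints.\<close>

definition chord :: "(real^2) set \<Rightarrow> real^2 \<Rightarrow> real^2 \<Rightarrow> bool" where
  "chord E p q \<longleftrightarrow> p \<in> E \<and> q \<in> E \<and> p \<noteq> q"

definition diameter_of :: "(real^2) set \<Rightarrow> real^2 \<Rightarrow> real^2 \<Rightarrow> bool" where
  "diameter_of E p q \<longleftrightarrow> chord E p q \<and> ellipse_center E \<in> closed_segment p q"

definition bisects_parallel_chords ::
  "(real^2) set \<Rightarrow> real^2 \<Rightarrow> real^2 \<Rightarrow> real^2 \<Rightarrow> real^2 \<Rightarrow> bool" where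
  "bisects_parallel_chords E p q r s \<longleftrightarrow>
     (\<forall>x y. chord E x y \<and> (\<exists>k. y - x = k *\<^sub>R (s - r)) \<longrightarrow> midpoint x y \<in> closed_segment p q)"

definition conjugate_diameters ::
  "(real^2) set \<Rightarrow> real^2 \<Rightarrow> real^2 \<Rightarrow> real^2 \<Rightarrow> real^2 \<Rightarrow> bool" where
  "conjugate_diameters E p q r s \<longleftrightarrow>
     diameter_of E p q \<and> diameter_of E r s \<and>
     bisects_parallel_chords E p q r s \<and> bisects_parallel_chords E r s p q"

definition equal_conjugate_diameters ::
  "(real^2) set \<Rightarrow> real^2 \<Rightarrow> real^2 \<Rightarrow> real^2 \<Rightarrow> real^2 \<Rightarrow> bool" where
  "equal_conjugate_diameters E p q r s \<longleftrightarrow> conjugate_diameters E p q r s \<and> dist p q = dist r s"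

text \<open>The absolute value makes this the angle in \<open>[0, \<pi>/2]\<close> between the undirected lines
  \<open>pq\<close> and \<open>rs\<close>; it is meant for \<open>p \<noteq> q\<close> and \<open>r \<noteq> s\<close>.\<close>

definition segment_angle :: "real^2 \<Rightarrow> real^2 \<Rightarrow> real^2 \<Rightarrow> real^2 \<Rightarrow> real" where
  "segment_angle p q r s = arccos (\<bar>(q - p) \<bullet> (s - r)\<bar> / (norm (q - p) * norm (s - r)))"

lemma ellipse_with_minus:
  assumes "ellipse_with c e f a b E" "x \<in> E"
  shows "2 *\<^sub>R c - x \<in> E"
proof -
  obtain t where "x = ellipse_point c e f a b t"
    using assms by (auto simp: ellipse_with_def)
  then have "2 *\<^sub>R c - x = ellipse_point c e f a b (t + pi)"
    by (simp add: ellipse_point_def scaleR_2)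
  then show ?thesis using assms by (auto simp: ellipse_with_def)
qed

lemma ellipse_with_norm:
  assumes "ellipse_with c e f a b E"
  shows "(norm (ellipse_point c e f a b t - c))\<^sup>2 = a\<^sup>2 * (cos t)\<^sup>2 + b\<^sup>2 * (sin t)\<^sup>2"
proof -
  have "e \<bullet> e = 1" "f \<bullet> f = 1" "e \<bullet> f = 0" "f \<bullet> e = 0"
    using assms by (auto simp: ellipse_with_def norm_eq_1 inner_commute)
  then show ?thesis
    unfolding power2_norm_eq_inner
    by (simp add: ellipse_point_def inner_add_left inner_add_right power2_eq_square algebra_simps)
qed

lemma ellipse_with_norm_bounds:
  assumes "ellipse_with c e f a b E" "x \<in> E"
  shows "norm (x - c) \<le> a" "b \<le> norm (x - c)"
proof -
  obtain t where x: "x = ellipse_point c e f a b t"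
    using assms by (auto simp: ellipse_with_def)
  have ab: "0 < b" "b \<le> a" using assms by (auto simp: ellipse_with_def)
  have ab2: "b\<^sup>2 \<le> a\<^sup>2" using ab by (intro power_mono) auto
  have s: "(sin t)\<^sup>2 = 1 - (cos t)\<^sup>2" by (simp add: sin_squared_eq)
  have n: "(norm (x - c))\<^sup>2 = b\<^sup>2 + (a\<^sup>2 - b\<^sup>2) * (cos t)\<^sup>2"
    unfolding x ellipse_with_norm[OF assms(1)] s by (simp add: algebra_simps)
  have c: "0 \<le> (cos t)\<^sup>2" "(cos t)\<^sup>2 \<le> 1" by (simp_all add: abs_square_le_1)
  have "(a\<^sup>2 - b\<^sup>2) * (cos t)\<^sup>2 \<le> (a\<^sup>2 - b\<^sup>2) * 1"
    using c ab2 by (intro mult_left_mono) auto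
  then have "(norm (x - c))\<^sup>2 \<le> a\<^sup>2" using n by simp
  then show "norm (x - c) \<le> a" by (rule power2_le_imp_le) (use ab in simp)
  have "b\<^sup>2 \<le> (norm (x - c))\<^sup>2" using n ab2 c by simp
  then show "b \<le> norm (x - c)" by (rule power2_le_imp_le) simp
qed

lemma ellipse_with_norm_attained:
  assumes "ellipse_with c e f a b E"
  shows "\<exists>x\<in>E. norm (x - c) = a" "\<exists>x\<in>E. norm (x - c) = b"
proof -
  have E: "E = range (ellipse_point c e f a b)" and ab: "0 < b" "b \<le> a" "norm e = 1" "norm f = 1"
    using assms by (auto simp: ellipse_with_def)
  have "ellipse_point c e f a b 0 \<in> E" unfolding E by (rule rangeI)
  moreover have "norm (ellipse_point c e f a b 0 - c) = a"
    using ab by (simp add: ellipse_point_def)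
  ultimately show "\<exists>x\<in>E. norm (x - c) = a" by blast
  have "ellipse_point c e f a b (pi/2) \<in> E" unfolding E by (rule rangeI)
  moreover have "norm (ellipse_point c e f a b (pi/2) - c) = b"
    using ab by (simp add: ellipse_point_def)
  ultimately show "\<exists>x\<in>E. norm (x - c) = b" by blast
qed

lemma ellipse_with_center_unique:
  assumes 1: "ellipse_with c e f a b E" and 2: "ellipse_with c' e' f' a' b' E"
  shows "c = c'"
proof (rule ccontr)
  assume "c \<noteq> c'"
  define w where "w = 2 *\<^sub>R (c - c')"
  have w: "w \<noteq> 0" using \<open>c \<noteq> c'\<close> by (simp add: w_def)
  obtain x0 where x0: "x0 \<in> E" using ellipse_with_norm_attained[OF 1] by blast
  have step: "x + w \<in> E" if "x \<in> E" for x
  proof -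
    have "2 *\<^sub>R c - (2 *\<^sub>R c' - x) \<in> E"
      using ellipse_with_minus[OF 1] ellipse_with_minus[OF 2] that by blast
    then show ?thesis by (simp add: w_def algebra_simps)
  qed
  have all: "x0 + real n *\<^sub>R w \<in> E" for n
  proof (induction n)
    case (Suc n)
    then show ?case using step by (fastforce simp: algebra_simps)
  qed (use x0 in simp)
  have "real n * norm w \<le> 2 * a" for n
  proof -
    have "norm (real n *\<^sub>R w) \<le> norm (x0 + real n *\<^sub>R w - c) + norm (x0 - c)"
      by (rule norm_triangle_sub[of "real n *\<^sub>R w" "- (x0 - c)", simplified norm_minus_cancel,
            THEN order_trans]) (simp add: algebra_simps)
    also have "\<dots> \<le> 2 * a"
      using ellipse_with_norm_bounds(1)[OF 1 all[of n]] ellipse_with_norm_bounds(1)[OF 1 x0] by simp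
    finally show ?thesis by simp
  qed
  moreover obtain n :: nat where "2 * a < real n * norm w"
    using reals_Archimedean3[of "norm w"] w by auto
  ultimately show False by (meson not_le)
qed

lemma ellipse_with_axes_unique:
  assumes 1: "ellipse_with c e f a b E" and 2: "ellipse_with c' e' f' a' b' E"
  shows "a = a'" "b = b'"
proof -
  have c: "c' = c" using ellipse_with_center_unique[OF 1 2] by simp
  note b1 = ellipse_with_norm_bounds[OF 1] and b2 = ellipse_with_norm_bounds[OF 2, unfolded c]
  note a1 = ellipse_with_norm_attained[OF 1] and a2 = ellipse_with_norm_attained[OF 2, unfolded c]
  show "a = a'" using b1 b2 a1 a2 by (metis order_antisym)
  show "b = b'" using b1 b2 a1 a2 by (metis order_antisym)
qed

lemma ellipse_center_eq:
  assumes "ellipse_with c e f a b E"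
  shows "ellipse_center E = c"
  unfolding ellipse_center_def
  using assms ellipse_with_center_unique by (intro the_equality) blast+

lemma eccentricity_eq:
  assumes "ellipse_with c e f a b E"
  shows "eccentricity E = sqrt (1 - b\<^sup>2 / a\<^sup>2)"
  unfolding eccentricity_def
  using assms ellipse_with_axes_unique[OF assms] by (intro the_equality) blast+

lemma bisects_parallel_chords_affine:
  fixes u v c :: "real^2"
  assumes E: "E = {c + \<alpha> *\<^sub>R u + \<beta> *\<^sub>R v |\<alpha> \<beta>. \<alpha>\<^sup>2 + \<beta>\<^sup>2 = 1}"
    and ind: "\<And>\<alpha> \<beta>. \<alpha> *\<^sub>R u + \<beta> *\<^sub>R v = 0 \<Longrightarrow> \<alpha> = 0 \<and> \<beta> = 0"
  shows "bisects_parallel_chords E (c - u) (c + u) (c - v) (c + v)"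
  unfolding bisects_parallel_chords_def
proof (intro allI impI, elim conjE exE)
  fix x y k
  assume ch: "chord E x y" and k: "y - x = k *\<^sub>R (c + v - (c - v))"
  obtain \<alpha> \<beta> where x: "x = c + \<alpha> *\<^sub>R u + \<beta> *\<^sub>R v" "\<alpha>\<^sup>2 + \<beta>\<^sup>2 = 1"
    using ch unfolding chord_def E by blast
  obtain \<alpha>' \<beta>' where y: "y = c + \<alpha>' *\<^sub>R u + \<beta>' *\<^sub>R v" "\<alpha>'\<^sup>2 + \<beta>'\<^sup>2 = 1"
    using ch unfolding chord_def E by blast
  have "(\<alpha>' - \<alpha>) *\<^sub>R u + (\<beta>' - \<beta> - 2 * k) *\<^sub>R v = (y - x) - k *\<^sub>R (c + v - (c - v))"
    unfolding x y by (simp add: vec_eq_iff algebra_simps)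
  then have "(\<alpha>' - \<alpha>) *\<^sub>R u + (\<beta>' - \<beta> - 2 * k) *\<^sub>R v = 0" using k by simp
  from ind[OF this] have a: "\<alpha>' = \<alpha>" by simp
  have "\<beta>'\<^sup>2 = \<beta>\<^sup>2" using x(2) y(2) a by simp
  moreover have "\<beta>' \<noteq> \<beta>" using ch a x y by (auto simp: chord_def)
  ultimately have b: "\<beta>' = - \<beta>" by (simp add: power2_eq_iff)
  have m: "midpoint x y = c + \<alpha> *\<^sub>R u"
    unfolding x y a b midpoint_def by (simp add: vec_eq_iff algebra_simps)
  have "\<alpha>\<^sup>2 \<le> 1" using x(2) zero_le_power2[of \<beta>] by linarith
  then have "\<bar>\<alpha>\<bar> \<le> 1" by (simp add: abs_square_le_1)
  moreover have "c + \<alpha> *\<^sub>R u = (1 - (1 + \<alpha>) / 2) *\<^sub>R (c - u) + ((1 + \<alpha>) / 2) *\<^sub>R (c + u)"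
    by (simp add: vec_eq_iff field_simps)
  ultimately show "midpoint x y \<in> closed_segment (c - u) (c + u)"
    unfolding m in_segment by (intro exI[of _ "(1 + \<alpha>) / 2"]) auto
qed

lemma equal_conjugate_diameters_exist:
  assumes "ellipse E"
  shows "\<exists>p q r s. equal_conjugate_diameters E p q r s"
proof -
  obtain c e f a b where w: "ellipse_with c e f a b E" using assms by (auto simp: ellipse_def)
  then have E: "E = range (ellipse_point c e f a b)" and ab: "0 < b" "b \<le> a"
    and ef: "norm e = 1" "norm f = 1" "e \<bullet> f = 0" "f \<bullet> e = 0" "e \<bullet> e = 1" "f \<bullet> f = 1"
    by (auto simp: ellipse_with_def inner_commute norm_eq_1)
  define u where "u = (a / sqrt 2) *\<^sub>R e + (b / sqrt 2) *\<^sub>R f"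
  define v where "v = (a / sqrt 2) *\<^sub>R e - (b / sqrt 2) *\<^sub>R f"
  have comb: "\<alpha> *\<^sub>R u + \<beta> *\<^sub>R v = (a * ((\<alpha> + \<beta>) / sqrt 2)) *\<^sub>R e + (b * ((\<alpha> - \<beta>) / sqrt 2)) *\<^sub>R f"
    for \<alpha> \<beta>
    by (simp add: u_def v_def algebra_simps add_divide_distrib diff_divide_distrib)
  have sq: "((\<alpha> + \<beta>) / sqrt 2)\<^sup>2 + ((\<alpha> - \<beta>) / sqrt 2)\<^sup>2 = \<alpha>\<^sup>2 + \<beta>\<^sup>2" for \<alpha> \<beta> :: real
    by (simp add: power_divide power2_sum power2_diff field_simps)
  have ind: "\<alpha> = 0 \<and> \<beta> = 0" if "\<alpha> *\<^sub>R u + \<beta> *\<^sub>R v = 0" for \<alpha> \<beta>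
  proof -
    have "(\<alpha> *\<^sub>R u + \<beta> *\<^sub>R v) \<bullet> e = 0" "(\<alpha> *\<^sub>R u + \<beta> *\<^sub>R v) \<bullet> f = 0" using that by simp_all
    then have "(\<alpha> + \<beta>) / sqrt 2 = 0" "(\<alpha> - \<beta>) / sqrt 2 = 0"
      unfolding comb inner_add_left inner_scaleR_left ef using ab by simp_all
    then show ?thesis by simp
  qed
  have E': "E = {c + \<alpha> *\<^sub>R u + \<beta> *\<^sub>R v |\<alpha> \<beta>. \<alpha>\<^sup>2 + \<beta>\<^sup>2 = 1}"
  proof (intro set_eqI iffI)
    fix x assume "x \<in> E"
    then obtain t where x: "x = ellipse_point c e f a b t" using E by auto
    define \<alpha> where "\<alpha> = (cos t + sin t) / sqrt 2"
    define \<beta> where "\<beta> = (cos t - sin t) / sqrt 2"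
    have r: "(\<alpha> + \<beta>) / sqrt 2 = cos t" "(\<alpha> - \<beta>) / sqrt 2 = sin t"
      by (simp_all add: \<alpha>_def \<beta>_def field_simps)
    have "x = c + \<alpha> *\<^sub>R u + \<beta> *\<^sub>R v"
      unfolding add.assoc comb r x ellipse_point_def ..
    moreover have "\<alpha>\<^sup>2 + \<beta>\<^sup>2 = 1" using sq[of \<alpha> \<beta>] unfolding r by simp
    ultimately show "x \<in> {c + \<alpha> *\<^sub>R u + \<beta> *\<^sub>R v |\<alpha> \<beta>. \<alpha>\<^sup>2 + \<beta>\<^sup>2 = 1}" by blast
  next
    fix x assume "x \<in> {c + \<alpha> *\<^sub>R u + \<beta> *\<^sub>R v |\<alpha> \<beta>. \<alpha>\<^sup>2 + \<beta>\<^sup>2 = 1}"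
    then obtain \<alpha> \<beta> where x: "x = c + \<alpha> *\<^sub>R u + \<beta> *\<^sub>R v" and one: "\<alpha>\<^sup>2 + \<beta>\<^sup>2 = 1" by blast
    obtain t where t: "(\<alpha> + \<beta>) / sqrt 2 = cos t" "(\<alpha> - \<beta>) / sqrt 2 = sin t"
      using sincos_total_2pi[of "(\<alpha> + \<beta>) / sqrt 2" "(\<alpha> - \<beta>) / sqrt 2"] sq[of \<alpha> \<beta>] one by metis
    have "x = ellipse_point c e f a b t"
      unfolding x add.assoc comb t ellipse_point_def ..
    then show "x \<in> E" unfolding E by (rule range_eqI)
  qed
  have swap: "{c + \<alpha> *\<^sub>R y + \<beta> *\<^sub>R z |\<alpha> \<beta>. \<alpha>\<^sup>2 + \<beta>\<^sup>2 = 1} \<subseteq>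
      {c + \<alpha> *\<^sub>R z + \<beta> *\<^sub>R y |\<alpha> \<beta>. \<alpha>\<^sup>2 + \<beta>\<^sup>2 = 1}" for y z
  proof
    fix x assume "x \<in> {c + \<alpha> *\<^sub>R y + \<beta> *\<^sub>R z |\<alpha> \<beta>. \<alpha>\<^sup>2 + \<beta>\<^sup>2 = 1}"
    then obtain \<alpha> \<beta> where "x = c + \<alpha> *\<^sub>R y + \<beta> *\<^sub>R z" "\<alpha>\<^sup>2 + \<beta>\<^sup>2 = 1" by blast
    then have "x = c + \<beta> *\<^sub>R z + \<alpha> *\<^sub>R y \<and> \<beta>\<^sup>2 + \<alpha>\<^sup>2 = 1" by simp
    then show "x \<in> {c + \<alpha> *\<^sub>R z + \<beta> *\<^sub>R y |\<alpha> \<beta>. \<alpha>\<^sup>2 + \<beta>\<^sup>2 = 1}" by blast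
  qed
  have E'': "E = {c + \<alpha> *\<^sub>R v + \<beta> *\<^sub>R u |\<alpha> \<beta>. \<alpha>\<^sup>2 + \<beta>\<^sup>2 = 1}"
    unfolding E' by (rule equalityI[OF swap swap])
  have mem: "c + \<alpha> *\<^sub>R u + \<beta> *\<^sub>R v \<in> E" if "\<alpha>\<^sup>2 + \<beta>\<^sup>2 = 1" for \<alpha> \<beta>
    unfolding E' using that by blast
  have nz: "u \<noteq> 0" "v \<noteq> 0" using ind[of 1 0] ind[of 0 1] by auto
  have dia: "diameter_of E (c - z) (c + z)" if "c - z \<in> E" "c + z \<in> E" "z \<noteq> 0" for z
  proof -
    have "(c + z) - (c - z) = 2 *\<^sub>R z" by (simp add: scaleR_2)
    then have "c - z \<noteq> c + z" using that(3) by (metis cancel_comm_monoid_add_class.diff_cancel scaleR_eq_0_iff zero_neq_numeral)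
    moreover have "c \<in> closed_segment (c - z) (c + z)"
      using midpoint_in_closed_segment[of "c - z" "c + z"]
      by (simp add: midpoint_def flip: scaleR_2)
    ultimately show ?thesis
      using that by (simp add: diameter_of_def chord_def ellipse_center_eq[OF w])
  qed
  have "diameter_of E (c - u) (c + u)" "diameter_of E (c - v) (c + v)"
    using mem[of "-1" 0] mem[of 1 0] mem[of 0 "-1"] mem[of 0 1] nz by (auto intro!: dia)
  moreover have "bisects_parallel_chords E (c - u) (c + u) (c - v) (c + v)"
    using bisects_parallel_chords_affine[OF E' ind] .
  moreover have "bisects_parallel_chords E (c - v) (c + v) (c - u) (c + u)"
    by (rule bisects_parallel_chords_affine[OF E'']) (metis add.commute ind)
  moreover have "dist (c - u) (c + u) = dist (c - v) (c + v)"
  proof -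
    have "u \<bullet> u = v \<bullet> v"
      unfolding u_def v_def
      by (simp add: inner_add_left inner_add_right inner_diff_left inner_diff_right ef)
    then have "norm u = norm v" by (simp add: norm_eq_sqrt_inner)
    moreover have "dist (c - z) (c + z) = 2 * norm z" for z
    proof -
      have "c - z - (c + z) = (-2) *\<^sub>R z" by (simp add: scaleR_2)
      then show ?thesis unfolding dist_norm by (simp only: norm_scaleR)
    qed
    ultimately show ?thesis by simp
  qed
  ultimately show ?thesis
    unfolding equal_conjugate_diameters_def conjugate_diameters_def by blast
qed

end

theory Submission imports Defs begin

text \<open>Put the centre of the parallelogram at \<open>c\<close> and its vertices at \<open>c \<plusminus> u \<plusminus> v\<close>. Measuring along
  the functionals dual to \<open>u\<close> and \<open>v\<close>, an inscribed ellipse has both coordinates ranging exactly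
  over \<open>[-1, 1]\<close>, so it is the curve \<open>c + cos t u + cos (t - \<phi>) v\<close> for some \<open>\<phi>\<close>. With
  \<open>P = |u|\<^sup>2 + |v|\<^sup>2\<close>, \<open>Q = u \<bullet> v\<close> and Gram determinant \<open>G\<close> of \<open>u, v\<close>, its semi-axes satisfy
  \<open>a\<^sup>2 + b\<^sup>2 = P + 2Q cos \<phi>\<close> and \<open>a\<^sup>2b\<^sup>2 = G sin\<^sup>2 \<phi>\<close>. The eccentricity decreases with
  \<open>a\<^sup>2b\<^sup>2/(a\<^sup>2 + b\<^sup>2)\<^sup>2\<close>, whose maximum is attained exactly when \<open>P cos \<phi> = - 2Q\<close>. Equal conjugate
  diameters make an angle with cosine \<open>(a\<^sup>2 - b\<^sup>2)/(a\<^sup>2 + b\<^sup>2)\<close>, and at the minimum its square is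
  \<open>(|u|\<^sup>2 - |v|\<^sup>2)\<^sup>2/(P\<^sup>2 - 4Q\<^sup>2)\<close>, the squared cosine of the angle between \<open>u + v\<close> and
  \<open>u - v\<close>.\<close>

section \<open>Semi-axes and eccentricity of ellipses given by conjugate half-diameters\<close>

definition gram_det :: "real^2 \<Rightarrow> real^2 \<Rightarrow> real" where
  "gram_det u v = (u \<bullet> u) * (v \<bullet> v) - (u \<bullet> v)\<^sup>2"

text \<open>For independent \<open>u\<close> and \<open>v\<close> these are conjugate half-diameters
  of an ellipse; the orthogonal case gives its semi-axes.\<close>

definition conj_curve :: "real^2 \<Rightarrow> real^2 \<Rightarrow> real^2 \<Rightarrow> real \<Rightarrow> real^2" where
  "conj_curve c u v t = c + cos t *\<^sub>R u + sin t *\<^sub>R v"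

lemma ellipse_point_conj_curve:
  "ellipse_point c e f a b = conj_curve c (a *\<^sub>R e) (b *\<^sub>R f)"
  by (simp add: ellipse_point_def conj_curve_def fun_eq_iff mult.commute)

text \<open>Rotating the pair of half-diameters only shifts the parameter, so the pair may be
  rotated until it is orthogonal without changing the curve.\<close>

lemma conj_curve_add:
  "conj_curve c (cos \<theta> *\<^sub>R u + sin \<theta> *\<^sub>R v) (cos \<theta> *\<^sub>R v - sin \<theta> *\<^sub>R u) t = conj_curve c u v (t + \<theta>)"
  by (simp add: conj_curve_def cos_add sin_add vec_eq_iff algebra_simps)

lemma range_shift: "range (\<lambda>t. f (t + \<theta>)) = range f" for \<theta> :: real
proof -
  have "f t = f ((t - \<theta>) + \<theta>)" for t by simp
  then show ?thesis by blast
qed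

lemma gram_det_scaleR: "gram_det (a *\<^sub>R u) (b *\<^sub>R v) = a\<^sup>2 * b\<^sup>2 * gram_det u v"
  by (simp add: gram_det_def power2_eq_square algebra_simps)

text \<open>With \<open>x\<close>, \<open>y\<close> as cosine and sine, the first identity and
  \<open>gram_det_rotate\<close> are the two theorems of Apollonius on conjugate half-diameters; the
  other two identities are double-angle formulas that locate the axes.\<close>

lemma inner_rotate:
  fixes u v :: "'a::real_inner"
  assumes "x\<^sup>2 + y\<^sup>2 = 1"
  defines "w \<equiv> x *\<^sub>R u + y *\<^sub>R v" and "z \<equiv> x *\<^sub>R v - y *\<^sub>R u"
  shows "w \<bullet> w + z \<bullet> z = u \<bullet> u + v \<bullet> v"
    and "w \<bullet> w - z \<bullet> z = (x\<^sup>2 - y\<^sup>2) * (u \<bullet> u - v \<bullet> v) + 4 * (x * y) * (u \<bullet> v)"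
    and "w \<bullet> z = (x\<^sup>2 - y\<^sup>2) * (u \<bullet> v) - x * y * (u \<bullet> u - v \<bullet> v)"
proof -
  have "w \<bullet> w + z \<bullet> z = (x\<^sup>2 + y\<^sup>2) * (u \<bullet> u + v \<bullet> v)"
    unfolding w_def z_def
    by (simp add: inner_add inner_diff inner_commute power2_eq_square algebra_simps)
  then show "w \<bullet> w + z \<bullet> z = u \<bullet> u + v \<bullet> v" using assms by simp
  show "w \<bullet> w - z \<bullet> z = (x\<^sup>2 - y\<^sup>2) * (u \<bullet> u - v \<bullet> v) + 4 * (x * y) * (u \<bullet> v)"
    unfolding w_def z_def
    by (simp add: inner_add inner_diff inner_commute power2_eq_square algebra_simps)
  show "w \<bullet> z = (x\<^sup>2 - y\<^sup>2) * (u \<bullet> v) - x * y * (u \<bullet> u - v \<bullet> v)"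
    unfolding w_def z_def
    by (simp add: inner_add inner_diff inner_commute power2_eq_square algebra_simps)
qed

lemma gram_det_rotate:
  assumes "x\<^sup>2 + y\<^sup>2 = 1"
  shows "gram_det (x *\<^sub>R u + y *\<^sub>R v) (x *\<^sub>R v - y *\<^sub>R u) = gram_det u v"
proof -
  have "gram_det (x *\<^sub>R u + y *\<^sub>R v) (x *\<^sub>R v - y *\<^sub>R u) = (x\<^sup>2 + y\<^sup>2)\<^sup>2 * gram_det u v"
    by (simp add: gram_det_def inner_add inner_diff inner_commute[of v u] power2_eq_square algebra_simps)
  then show ?thesis using assms by simp
qed

lemma polar_obtain:
  obtains r \<theta> :: real where "0 \<le> r" "x = r * cos \<theta>" "y = r * sin \<theta>"
proof -
  define z where "z = Complex x y"
  have "rcis (cmod z) (Arg z) = z" by (rule rcis_cmod_Arg)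
  from arg_cong[OF this, of Re] arg_cong[OF this, of Im]
  have "x = cmod z * cos (Arg z)" "y = cmod z * sin (Arg z)"
    unfolding Re_rcis Im_rcis by (simp_all add: z_def)
  then show ?thesis using that norm_ge_zero by blast
qed

text \<open>The shift \<open>\<theta>\<close> is recorded because tangency is defined through
  \<open>ellipse_point\<close>, whereas contact points will be known in the parameter of the given
  curve.\<close>

lemma principal_axes:
  assumes "gram_det u v > 0"
  obtains e f a b \<theta> where "ellipse_with c e f a b (range (conj_curve c u v))"
    "\<And>t. ellipse_point c e f a b t = conj_curve c u v (t + \<theta>)"
    "a\<^sup>2 + b\<^sup>2 = u \<bullet> u + v \<bullet> v" "a\<^sup>2 * b\<^sup>2 = gram_det u v"
proof -
  \<comment> \<open>With \<open>w = cos \<theta> u + sin \<theta> v\<close> and \<open>z\<close> its derivative, \<open>(|w|\<^sup>2 - |z|\<^sup>2)/2\<close> and \<open>w \<bullet> z\<close> rotate with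
    angle \<open>2\<theta>\<close>; choose \<open>2\<theta>\<close> as their polar angle to make the second vanish.\<close>
  obtain R \<eta> where R: "0 \<le> R" "(u \<bullet> u - v \<bullet> v) / 2 = R * cos \<eta>" "u \<bullet> v = R * sin \<eta>"
    by (rule polar_obtain)
  define \<theta> where "\<theta> = \<eta> / 2"
  have \<eta>: "cos \<eta> = (cos \<theta>)\<^sup>2 - (sin \<theta>)\<^sup>2" "sin \<eta> = 2 * sin \<theta> * cos \<theta>"
    unfolding \<theta>_def using cos_double[of "\<eta>/2"] sin_double[of "\<eta>/2"] by simp_all
  have D: "u \<bullet> u - v \<bullet> v = 2 * R * cos \<eta>" using R by simp
  define w where "w = cos \<theta> *\<^sub>R u + sin \<theta> *\<^sub>R v"
  define z where "z = cos \<theta> *\<^sub>R v - sin \<theta> *\<^sub>R u"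
  have one: "(cos \<theta>)\<^sup>2 + (sin \<theta>)\<^sup>2 = 1" by simp
  note rot = inner_rotate[OF one, of u v, folded w_def z_def]
  have sc: "cos \<theta> * sin \<theta> = sin \<eta> / 2" using \<eta> by simp
  \<comment> \<open>As \<open>R\<close> is nonnegative, this polar angle makes \<open>w\<close>, not
    \<open>z\<close>, the major half-axis.\<close>
  have "w \<bullet> w - z \<bullet> z = 2 * R * ((cos \<eta>)\<^sup>2 + (sin \<eta>)\<^sup>2)"
    unfolding rot(2) sc \<eta>(1)[symmetric] D R(3)
    by (simp add: power2_eq_square algebra_simps del: sin_cos_squared_add sin_cos_squared_add2 sin_cos_squared_add3)
  then have le: "z \<bullet> z \<le> w \<bullet> w" using R(1) by simp
  have orth: "w \<bullet> z = 0"
    unfolding rot(3) sc \<eta>(1)[symmetric] D R(3) by simp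
  have det: "(w \<bullet> w) * (z \<bullet> z) = gram_det u v"
    using gram_det_rotate[OF one, of u v, folded w_def z_def] orth by (simp add: gram_det_def)
  then have nz: "w \<noteq> 0" "z \<noteq> 0" using assms by auto
  define a b where "a = norm w" and "b = norm z"
  define e f where "e = (1 / a) *\<^sub>R w" and "f = (1 / b) *\<^sub>R z"
  have sq: "a\<^sup>2 = w \<bullet> w" "b\<^sup>2 = z \<bullet> z" unfolding a_def b_def by (simp_all add: power2_norm_eq_inner)
  have pos: "0 < a" "0 < b" using nz by (simp_all add: a_def b_def)
  have "b \<le> a" using le sq pos by (metis less_imp_le power2_le_imp_le)
  have ae: "a *\<^sub>R e = w" "b *\<^sub>R f = z" using pos by (simp_all add: e_def f_def)
  have ef: "norm e = 1" "norm f = 1" "e \<bullet> f = 0"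
    using nz orth by (simp_all add: e_def f_def a_def b_def)
  have pt: "ellipse_point c e f a b t = conj_curve c u v (t + \<theta>)" for t
    unfolding ellipse_point_conj_curve ae w_def z_def by (rule conj_curve_add)
  have "range (ellipse_point c e f a b) = range (conj_curve c u v)"
    unfolding pt[abs_def] by (rule range_shift)
  then have "ellipse_with c e f a b (range (conj_curve c u v))"
    using ef pos \<open>b \<le> a\<close> by (simp add: ellipse_with_def)
  then show ?thesis using that[OF _ pt] sq det rot(1) by simp
qed

text \<open>The eccentricity decreases in \<open>r = b^2 / a^2\<close>, while
  \<open>r / (1 + r)^2\<close> increases on (0, 1]. The comparison is thus expressible by sum and
  product of the squared semi-axes, the quantities computable for inscribed ellipses.\<close>

lemma eccentricity_le_iff:
  assumes 1: "ellipse_with c e f a b E" and 2: "ellipse_with c' e' f' a' b' E'"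
  shows "eccentricity E' \<le> eccentricity E \<longleftrightarrow>
    a\<^sup>2 * b\<^sup>2 * (a'\<^sup>2 + b'\<^sup>2)\<^sup>2 \<le> a'\<^sup>2 * b'\<^sup>2 * (a\<^sup>2 + b\<^sup>2)\<^sup>2"
proof -
  have ab: "0 < b" "b \<le> a" "0 < b'" "b' \<le> a'" using 1 2 by (auto simp: ellipse_with_def)
  define x y x' y' where "x = a\<^sup>2" and "y = b\<^sup>2" and "x' = a'\<^sup>2" and "y' = b'\<^sup>2"
  have o: "0 < y" "y \<le> x" "0 < y'" "y' \<le> x'"
    unfolding x_def y_def x'_def y'_def using ab by (auto intro: power_mono)
  have id: "x' * y' * (x + y)\<^sup>2 - x * y * (x' + y')\<^sup>2 = (x * y' - y * x') * (x * x' - y * y')"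
    by (simp add: power2_eq_square algebra_simps)
  have ge: "y * y' \<le> x * x'" using o by (intro mult_mono) auto
  \<comment> \<open>The factor \<open>x * x' - y * y'\<close> vanishes only for two circles; then
    the other factor vanishes too, so the sign of the product always decides.\<close>
  have eq: "x * y' = y * x'" if "x * x' = y * y'"
  proof -
    have "x * x' \<ge> x * y'" "x * y' \<ge> y * y'" using o by (auto intro: mult_left_mono)
    moreover have "x * x' \<ge> y * x'" "y * x' \<ge> y * y'" using o by (auto intro: mult_left_mono)
    ultimately show ?thesis using that by linarith
  qed
  have "eccentricity E' \<le> eccentricity E \<longleftrightarrow> y / x \<le> y' / x'"
    unfolding eccentricity_eq[OF 1] eccentricity_eq[OF 2] x_def y_def x'_def y'_def by simp
  also have "\<dots> \<longleftrightarrow> 0 \<le> x * y' - y * x'"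
    using o by (simp add: field_simps)
  also have "\<dots> \<longleftrightarrow> 0 \<le> (x * y' - y * x') * (x * x' - y * y')"
    using ge eq by (cases "x * x' = y * y'") (auto simp: zero_le_mult_iff)
  also have "\<dots> \<longleftrightarrow> x * y * (x' + y')\<^sup>2 \<le> x' * y' * (x + y)\<^sup>2"
    unfolding id[symmetric] by simp
  finally show ?thesis unfolding x_def y_def x'_def y'_def .
qed

section \<open>Equal conjugate diameters\<close>

lemma orthonormal_comb_eq_iff:
  assumes "norm e = 1" "norm f = 1" "e \<bullet> f = 0"
  shows "x *\<^sub>R e + y *\<^sub>R f = x' *\<^sub>R e + y' *\<^sub>R f \<longleftrightarrow> x = x' \<and> y = y'"
proof
  assume eq: "x *\<^sub>R e + y *\<^sub>R f = x' *\<^sub>R e + y' *\<^sub>R f"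
  have "e \<bullet> e = 1" "f \<bullet> f = 1" "f \<bullet> e = 0"
    using assms by (simp_all add: norm_eq_1 inner_commute)
  then show "x = x' \<and> y = y'"
    using arg_cong[OF eq, of "\<lambda>z. z \<bullet> e"] arg_cong[OF eq, of "\<lambda>z. z \<bullet> f"] assms
    by (simp add: inner_add_left)
qed simp

text \<open>After scaling by the semi-axes both endpoints are unit vectors, and their mean with
  weights \<open>1 - l\<close> and \<open>l\<close> is zero; comparing lengths gives
  \<open>(1 - l)^2 = l^2\<close>.\<close>

lemma diameter_of_antipodal:
  assumes E: "ellipse_with c e f a b E" and pq: "diameter_of E p q"
  obtains t where "p = ellipse_point c e f a b t" "q = ellipse_point c e f a b (t + pi)"
proof -
  have ab: "0 < b" "b \<le> a" and ef: "norm e = 1" "norm f = 1" "e \<bullet> f = 0"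
    using E by (auto simp: ellipse_with_def)
  obtain t t' where p: "p = ellipse_point c e f a b t" and q: "q = ellipse_point c e f a b t'"
    using E pq by (auto simp: diameter_of_def chord_def ellipse_with_def)
  obtain l where l: "c = (1 - l) *\<^sub>R p + l *\<^sub>R q"
    using pq ellipse_center_eq[OF E] by (auto simp: diameter_of_def in_segment)
  have "(a * ((1 - l) * cos t + l * cos t')) *\<^sub>R e + (b * ((1 - l) * sin t + l * sin t')) *\<^sub>R f
      = (1 - l) *\<^sub>R p + l *\<^sub>R q - c"
    unfolding p q ellipse_point_def by (simp add: vec_eq_iff algebra_simps)
  also have "\<dots> = 0 *\<^sub>R e + 0 *\<^sub>R f" using l by simp
  finally have 0: "(1 - l) * cos t = - (l * cos t')" "(1 - l) * sin t = - (l * sin t')"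
    unfolding orthonormal_comb_eq_iff[OF ef] using ab by auto
  have "(1 - l)\<^sup>2 * ((cos t)\<^sup>2 + (sin t)\<^sup>2) = l\<^sup>2 * ((cos t')\<^sup>2 + (sin t')\<^sup>2)"
    unfolding distrib_left power_mult_distrib[symmetric] 0 by simp
  then have l: "l = 1 / 2" by (simp add: power2_eq_square algebra_simps)
  have "cos t' = - cos t" "sin t' = - sin t" using 0 unfolding l by simp_all
  then have "q = ellipse_point c e f a b (t + pi)" unfolding q ellipse_point_def by simp
  then show ?thesis using that p by blast
qed

text \<open>The conclusion is \<open>cos (t - t') = 0\<close>: the affine map taking the ellipse to
  a circle makes conjugate diameters perpendicular.\<close>

lemma bisects_parallel_chords_cos:
  assumes E: "ellipse_with c e f a b E"
    and bis: "bisects_parallel_chords E (ellipse_point c e f a b t) (ellipse_point c e f a b (t + pi))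
      (ellipse_point c e f a b t') (ellipse_point c e f a b (t' + pi))"
  shows "cos t * cos t' + sin t * sin t' = 0"
proof -
  let ?P = "ellipse_point c e f a b"
  have ab: "0 < b" "b \<le> a" and ef: "norm e = 1" "norm f = 1" "e \<bullet> f = 0"
    and range: "E = range ?P"
    using E by (auto simp: ellipse_with_def)
  \<comment> \<open>Any chord parallel to the second diameter and missing the centre would do as a test chord.\<close>
  define x where "x = ?P (t' + pi / 6)"
  define y where "y = ?P (t' + pi - pi / 6)"
  have x: "x = c + (a * (sqrt 3 / 2 * cos t' - sin t' / 2)) *\<^sub>R e
      + (b * (sqrt 3 / 2 * sin t' + cos t' / 2)) *\<^sub>R f"
    unfolding x_def ellipse_point_def cos_add sin_add cos_30 sin_30
    by (simp add: algebra_simps)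
  have y: "y = c + (a * (- (sqrt 3 / 2) * cos t' - sin t' / 2)) *\<^sub>R e
      + (b * (- (sqrt 3 / 2) * sin t' + cos t' / 2)) *\<^sub>R f"
    unfolding y_def ellipse_point_def cos_diff sin_diff cos_30 sin_30
    by (simp add: algebra_simps)
  have yx: "y - x = (- sqrt 3) *\<^sub>R ((a * cos t') *\<^sub>R e + (b * sin t') *\<^sub>R f)"
    unfolding x y by (simp add: vec_eq_iff algebra_simps)
  have "(a * cos t') *\<^sub>R e + (b * sin t') *\<^sub>R f \<noteq> 0 *\<^sub>R e + 0 *\<^sub>R f"
    unfolding orthonormal_comb_eq_iff[OF ef] using ab sin_zero_abs_cos_one[of t'] by auto
  then have "y - x \<noteq> 0" unfolding yx by simp
  then have "chord E x y" unfolding chord_def range x_def y_def by auto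
  moreover have "y - x = (sqrt 3 / 2) *\<^sub>R (?P (t' + pi) - ?P t')"
    unfolding yx by (simp add: ellipse_point_def vec_eq_iff algebra_simps)
  ultimately have "midpoint x y \<in> closed_segment (?P t) (?P (t + pi))"
    using bis unfolding bisects_parallel_chords_def by blast
  then obtain l where l: "midpoint x y = (1 - l) *\<^sub>R ?P t + l *\<^sub>R ?P (t + pi)"
    by (auto simp: in_segment)
  \<comment> \<open>The midpoint lies halfway from the centre to the ellipse point with parameter
    \<open>t' + pi / 2\<close>; it is also on the first diameter.\<close>
  have "(a * (- sin t' / 2)) *\<^sub>R e + (b * (cos t' / 2)) *\<^sub>R f = midpoint x y - c"
    unfolding x y midpoint_def by (simp add: vec_eq_iff algebra_simps)
  also have "\<dots> = (a * ((1 - 2 * l) * cos t)) *\<^sub>R e + (b * ((1 - 2 * l) * sin t)) *\<^sub>R f"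
    unfolding l ellipse_point_def by (simp add: vec_eq_iff algebra_simps)
  finally have "a * (- sin t' / 2) = a * ((1 - 2 * l) * cos t)"
    "b * (cos t' / 2) = b * ((1 - 2 * l) * sin t)"
    unfolding orthonormal_comb_eq_iff[OF ef] by simp_all
  then have eq: "- sin t' / 2 = (1 - 2 * l) * cos t" "cos t' / 2 = (1 - 2 * l) * sin t"
    unfolding mult_cancel_left using ab by simp_all
  define m where "m = 2 * (1 - 2 * l)"
  have s: "sin t' = - (m * cos t)" and c: "cos t' = m * sin t"
    using eq by (simp_all add: m_def field_simps)
  show ?thesis unfolding s c by simp
qed

text \<open>Perpendicular parameters interchange squared cosine and sine, so the squared lengths add
  up to \<open>4 * (a^2 + b^2)\<close>. Equal lengths force \<open>x^2 = y^2\<close> unless the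
  ellipse is a circle, where the inner product vanishes anyway.\<close>

lemma equal_conjugate_diameters_angle:
  assumes E: "ellipse_with c e f a b E" and eq: "equal_conjugate_diameters E p q r s"
  shows "segment_angle p q r s = arccos ((a\<^sup>2 - b\<^sup>2) / (a\<^sup>2 + b\<^sup>2))"
proof -
  let ?P = "ellipse_point c e f a b"
  have ab: "0 < b" "b \<le> a" and ef: "norm e = 1" "norm f = 1" "e \<bullet> f = 0"
    using E by (auto simp: ellipse_with_def)
  have ii: "e \<bullet> e = 1" "f \<bullet> f = 1" "f \<bullet> e = 0"
    using ef by (simp_all add: norm_eq_1 inner_commute)
  have dia: "diameter_of E p q" "diameter_of E r s"
    and bis: "bisects_parallel_chords E p q r s" and dist: "dist p q = dist r s"
    using eq by (auto simp: equal_conjugate_diameters_def conjugate_diameters_def)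
  obtain t where t: "p = ?P t" "q = ?P (t + pi)" using diameter_of_antipodal[OF E dia(1)] .
  obtain t' where t': "r = ?P t'" "s = ?P (t' + pi)" using diameter_of_antipodal[OF E dia(2)] .
  define x y x' y' where "x = cos t" and "y = sin t" and "x' = cos t'" and "y' = sin t'"
  have orth: "x * x' + y * y' = 0"
    using bisects_parallel_chords_cos[OF E bis[unfolded t t']]
    by (simp add: x_def y_def x'_def y'_def)
  have one: "x\<^sup>2 + y\<^sup>2 = 1" "x'\<^sup>2 + y'\<^sup>2 = 1" by (simp_all add: x_def y_def x'_def y'_def)
  have v: "q - p = (-2) *\<^sub>R ((a * x) *\<^sub>R e + (b * y) *\<^sub>R f)"
    "s - r = (-2) *\<^sub>R ((a * x') *\<^sub>R e + (b * y') *\<^sub>R f)"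
    unfolding t t' ellipse_point_def x_def y_def x'_def y'_def
    by (simp_all add: vec_eq_iff algebra_simps)
  have xx: "(x * x')\<^sup>2 = (y * y')\<^sup>2" using orth by (metis add_eq_0_iff power2_minus)
  have "x\<^sup>2 * (x'\<^sup>2 + y'\<^sup>2) = (x\<^sup>2 + y\<^sup>2) * y'\<^sup>2"
    using xx by (simp add: power_mult_distrib algebra_simps)
  then have xy: "x\<^sup>2 = y'\<^sup>2" "y\<^sup>2 = x'\<^sup>2" using one by simp_all
  have n: "(q - p) \<bullet> (q - p) = 4 * (a\<^sup>2 * x\<^sup>2 + b\<^sup>2 * y\<^sup>2)"
    "(s - r) \<bullet> (s - r) = 4 * (a\<^sup>2 * x'\<^sup>2 + b\<^sup>2 * y'\<^sup>2)"
    "(q - p) \<bullet> (s - r) = 4 * (a\<^sup>2 * (x * x') + b\<^sup>2 * (y * y'))"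
    unfolding v by (simp_all add: inner_add ef ii power2_eq_square algebra_simps)
  have norms: "norm (q - p) = norm (s - r)"
    using dist by (simp add: dist_norm norm_minus_commute)
  then have "a\<^sup>2 * x\<^sup>2 + b\<^sup>2 * y\<^sup>2 = a\<^sup>2 * x'\<^sup>2 + b\<^sup>2 * y'\<^sup>2"
    using n(1,2) by (simp add: dot_square_norm)
  then have h: "(a\<^sup>2 - b\<^sup>2) * (x\<^sup>2 - y\<^sup>2) = 0" using xy by (simp add: algebra_simps)
  have "(q - p) \<bullet> (q - p) + (s - r) \<bullet> (s - r) = 4 * (a\<^sup>2 + b\<^sup>2)"
  proof -
    have "a\<^sup>2 * (x\<^sup>2 + y\<^sup>2) = a\<^sup>2" "b\<^sup>2 * (x\<^sup>2 + y\<^sup>2) = b\<^sup>2" using one by simp_all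
    then show ?thesis unfolding n xy[symmetric] by (simp add: algebra_simps)
  qed
  then have den: "norm (q - p) * norm (s - r) = 2 * (a\<^sup>2 + b\<^sup>2)"
    unfolding norms by (simp add: dot_square_norm norms power2_eq_square)
  define d where "d = a\<^sup>2 - b\<^sup>2"
  have "b\<^sup>2 \<le> a\<^sup>2" using ab by (intro power_mono) auto
  then have d: "0 \<le> d" by (simp add: d_def)
  have yy: "y * y' = - (x * x')" using orth by linarith
  have "(q - p) \<bullet> (s - r) = 4 * (d * (x * x'))"
    unfolding n(3) yy d_def by (simp add: algebra_simps)
  then have "((q - p) \<bullet> (s - r))\<^sup>2 = 16 * d\<^sup>2 * x\<^sup>2 * y\<^sup>2"
    unfolding xy(2) by (simp add: power_mult_distrib)
  \<comment> \<open>Writing \<open>4 * x^2 * y^2\<close> as a difference of squares lets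
    \<open>h\<close> apply to circles and non-circles alike.\<close>
  also have "\<dots> = 4 * (d\<^sup>2 * (x\<^sup>2 + y\<^sup>2)\<^sup>2 - (d * (x\<^sup>2 - y\<^sup>2))\<^sup>2)"
    by (simp add: power2_eq_square algebra_simps)
  also have "\<dots> = (2 * d)\<^sup>2" using h one by (simp add: d_def[symmetric] power_mult_distrib)
  finally have "\<bar>(q - p) \<bullet> (s - r)\<bar>\<^sup>2 = (2 * d)\<^sup>2" by simp
  then have num: "\<bar>(q - p) \<bullet> (s - r)\<bar> = 2 * (a\<^sup>2 - b\<^sup>2)"
    unfolding d_def[symmetric] by (rule power2_eq_imp_eq) (use d in auto)
  show ?thesis unfolding segment_angle_def num den
    by (subst mult_divide_mult_cancel_left) simp_all
qed

section \<open>Gram determinants, touching slabs and dual coordinates\<close>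

lemma gram_det_comb:
  "gram_det (x *\<^sub>R u + y *\<^sub>R v) (x' *\<^sub>R u + y' *\<^sub>R v) = (x * y' - y * x')\<^sup>2 * gram_det u v"
  by (simp add: gram_det_def inner_add inner_commute[of v u] power2_eq_square algebra_simps)

text \<open>Positivity is strict Cauchy-Schwarz, whose equality case is collinearity.\<close>

lemma gram_det_pos_iff: "gram_det u v > 0 \<longleftrightarrow> \<not> collinear {0, u, v}"
proof -
  have "gram_det u v = (norm u * norm v)\<^sup>2 - \<bar>u \<bullet> v\<bar>\<^sup>2"
    by (simp add: gram_det_def power_mult_distrib dot_square_norm)
  then have "gram_det u v > 0 \<longleftrightarrow> \<bar>u \<bullet> v\<bar>\<^sup>2 < (norm u * norm v)\<^sup>2" by simp
  also have "\<dots> \<longleftrightarrow> \<bar>u \<bullet> v\<bar> < norm u * norm v"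
    by (metis abs_ge_zero mult_nonneg_nonneg norm_ge_zero power2_less_imp_less power_strict_mono
        zero_less_numeral)
  also have "\<dots> \<longleftrightarrow> \<bar>u \<bullet> v\<bar> \<noteq> norm u * norm v"
    using Cauchy_Schwarz_ineq2[of u v] by linarith
  finally show ?thesis by (simp add: norm_cauchy_schwarz_equal)
qed

lemma convex_slab: "convex {x. \<bar>m \<bullet> (x - c)\<bar> \<le> (1::real)}" for m :: "'a::real_inner"
proof -
  have "{x. \<bar>m \<bullet> (x - c)\<bar> \<le> 1} = {x. m \<bullet> x \<le> 1 + m \<bullet> c} \<inter> {x. m \<bullet> x \<ge> m \<bullet> c - 1}"
    by (auto simp: inner_diff_right abs_le_iff)
  then show ?thesis by (simp add: convex_Int convex_halfspace_le convex_halfspace_ge)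
qed

text \<open>Reflecting the two contact points in \<open>c'\<close> keeps them in the slab, which
  forces the centre onto its midline. The functional along the ellipse is then a cosine of amplitude
  \<open>R\<close>, and containment with contact gives \<open>R = 1\<close>.\<close>

lemma ellipse_touching_slab:
  assumes E: "ellipse_with c' e f a b E"
    and slab: "\<And>x. x \<in> E \<Longrightarrow> \<bar>m \<bullet> (x - c)\<bar> \<le> 1"
    and touch: "x1 \<in> E" "m \<bullet> (x1 - c) = 1" "x2 \<in> E" "m \<bullet> (x2 - c) = - 1"
  obtains \<theta> where "m \<bullet> c' = m \<bullet> c" "m \<bullet> (a *\<^sub>R e) = cos \<theta>" "m \<bullet> (b *\<^sub>R f) = sin \<theta>"
proof -
  have centre: "m \<bullet> c' = m \<bullet> c"
    using slab[OF ellipse_with_minus[OF E touch(1)]] slab[OF ellipse_with_minus[OF E touch(3)]]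
      touch(2,4)
    by (simp add: inner_diff_right)
  obtain R \<theta> where R: "0 \<le> R" "m \<bullet> (a *\<^sub>R e) = R * cos \<theta>" "m \<bullet> (b *\<^sub>R f) = R * sin \<theta>"
    by (rule polar_obtain)
  have pt: "m \<bullet> (ellipse_point c' e f a b t - c) = R * cos (t - \<theta>)" for t
    unfolding ellipse_point_conj_curve conj_curve_def inner_diff_right inner_add_right
      inner_scaleR_right[of m "cos t"] inner_scaleR_right[of m "sin t"] R(2,3) centre cos_diff
    by (simp add: algebra_simps)
  have range: "E = range (ellipse_point c' e f a b)" using E by (simp add: ellipse_with_def)
  have "R \<le> 1" using slab[of "ellipse_point c' e f a b \<theta>"] R(1) unfolding pt range by simp
  moreover obtain t where "R * cos (t - \<theta>) = 1" using touch(1,2) pt unfolding range by auto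
  then have "1 \<le> R" using R(1) mult_left_mono[OF cos_le_one R(1), of "t - \<theta>"] by simp
  ultimately have "R = 1" by simp
  then show ?thesis using that centre R by simp
qed

text \<open>First vector of the basis dual to \<open>u\<close>, \<open>v\<close>; swapping the
  arguments gives the second.\<close>

definition dual_vec :: "real^2 \<Rightarrow> real^2 \<Rightarrow> real^2" where
  "dual_vec u v = (1 / gram_det u v) *\<^sub>R ((v \<bullet> v) *\<^sub>R u - (u \<bullet> v) *\<^sub>R v)"

lemma gram_det_commute: "gram_det u v = gram_det v u"
  by (simp add: gram_det_def inner_commute)

lemma dual_vec_inner:
  assumes "gram_det u v > 0"
  shows "dual_vec u v \<bullet> u = 1" "dual_vec u v \<bullet> v = 0"
proof -
  have "dual_vec u v \<bullet> u = gram_det u v / gram_det u v"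
    by (simp add: dual_vec_def inner_diff_left inner_commute[of v u] power2_eq_square
        gram_det_def mult.commute)
  then show "dual_vec u v \<bullet> u = 1" using assms by simp
  show "dual_vec u v \<bullet> v = 0"
    by (simp add: dual_vec_def inner_diff_left inner_commute[of v u])
qed

text \<open>Cramer's rule in the plane yields some coefficients, and the dual vectors read them
  off.\<close>

lemma dual_vec_expansion:
  assumes "gram_det u v > 0"
  shows "w = (dual_vec u v \<bullet> w) *\<^sub>R u + (dual_vec v u \<bullet> w) *\<^sub>R v"
proof -
  define d where "d = u $ 1 * v $ 2 - u $ 2 * v $ 1"
  have d: "gram_det u v = d\<^sup>2"
    by (simp add: gram_det_def d_def inner_vec_def sum_2 power2_eq_square algebra_simps)
  then have d0: "d \<noteq> 0" using assms by auto
  define x where "x = (w $ 1 * v $ 2 - w $ 2 * v $ 1) / d"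
  define y where "y = (u $ 1 * w $ 2 - u $ 2 * w $ 1) / d"
  have "d *\<^sub>R w = d *\<^sub>R (x *\<^sub>R u + y *\<^sub>R v)"
    unfolding scaleR_add_right scaleR_scaleR x_def y_def using d0
    by (simp add: vec_eq_iff forall_2) (simp add: d_def algebra_simps)
  then have w: "w = x *\<^sub>R u + y *\<^sub>R v" using d0 by simp
  have "gram_det v u > 0" using assms by (simp add: gram_det_commute)
  then show ?thesis
    unfolding w using dual_vec_inner assms by (simp add: inner_add_right)
qed

text \<open>Interpolate along \<open>u\<close> on two opposite sides, then along \<open>v\<close>
  between the points obtained.\<close>

lemma mem_parallelogram_hull:
  fixes c u v :: "'a::real_vector"
  assumes "\<bar>x\<bar> \<le> 1" "\<bar>y\<bar> \<le> 1"
  shows "c + x *\<^sub>R u + y *\<^sub>R v \<in> convex hull {c - u - v, c + u - v, c + u + v, c - u + v}"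
    (is "_ \<in> convex hull ?P")
proof -
  have step: "p + z *\<^sub>R w \<in> convex hull ?P"
    if "p - w \<in> convex hull ?P" "p + w \<in> convex hull ?P" "\<bar>z\<bar> \<le> 1" for p w and z :: real
  proof -
    define h where "h = (1 + z) / 2"
    have h: "0 \<le> 1 - h" "0 \<le> h" and z: "z = 2 * h - 1" using that(3) by (auto simp: h_def field_simps)
    have "(1 - h) *\<^sub>R (p - w) + h *\<^sub>R (p + w) = p + z *\<^sub>R w"
      unfolding z by (simp add: algebra_simps flip: scaleR_2)
    then show ?thesis using convexD[OF convex_convex_hull that(1,2) h] by simp
  qed
  have mem: "p \<in> convex hull ?P" if "p \<in> ?P" for p using that by (rule hull_inc)
  have "c - v + x *\<^sub>R u \<in> convex hull ?P" "c + v + x *\<^sub>R u \<in> convex hull ?P"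
    by (rule step[OF mem mem assms(1)]; simp add: algebra_simps)+
  then show ?thesis by (intro step assms(2)) (simp_all add: algebra_simps)
qed

section \<open>Ellipses inscribed in a parallelogram\<close>

locale nondegenerate_parallelogram =
  fixes c u v :: "real^2"
  assumes gram_pos: "gram_det u v > 0"
begin

text \<open>For \<open>sin \<phi> \<noteq> 0\<close>, these are the parametrised ellipses inscribed in the parallelogram with
  vertices \<open>c \<plusminus> u \<plusminus> v\<close>.\<close>

definition touching_curve :: "real \<Rightarrow> real \<Rightarrow> real^2" where
  "touching_curve \<phi> t = c + cos t *\<^sub>R u + cos (t - \<phi>) *\<^sub>R v"

abbreviation inscribed :: "(real^2) set \<Rightarrow> bool" where
  "inscribed \<equiv> inscribed_ellipse (c - u - v) (c + u - v) (c + u + v) (c - u + v)"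

text \<open>Negating \<open>\<phi>\<close> only reverses the parameter. Minimality will determine no
  more than \<open>cos \<phi>\<close>, so uniqueness rests on this.\<close>

lemma range_touching_curve_cong:
  assumes "cos \<phi> = cos \<psi>"
  shows "range (touching_curve \<phi>) = range (touching_curve \<psi>)"
proof -
  have sub: "range (touching_curve \<alpha>) \<subseteq> range (touching_curve \<beta>)" if eq: "cos \<alpha> = cos \<beta>" for \<alpha> \<beta>
  proof
    fix x assume "x \<in> range (touching_curve \<alpha>)"
    then obtain t where x: "x = touching_curve \<alpha> t" by auto
    have "(sin \<alpha>)\<^sup>2 = (sin \<beta>)\<^sup>2" using eq by (simp add: sin_squared_eq)
    then consider "sin \<alpha> = sin \<beta>" | "sin \<alpha> = - sin \<beta>" by (auto simp: power2_eq_iff)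
    then show "x \<in> range (touching_curve \<beta>)"
    proof cases
      case 1
      then have "x = touching_curve \<beta> t" by (simp add: x touching_curve_def cos_diff eq)
      then show ?thesis by blast
    next
      case 2
      then have "x = touching_curve \<beta> (- t)" by (simp add: x touching_curve_def cos_diff eq)
      then show ?thesis by blast
    qed
  qed
  show ?thesis using sub[of \<phi> \<psi>] sub[of \<psi> \<phi>] assms by auto
qed

lemma inscribed_imp_touching_curve:
  assumes ins: "inscribed E" and E: "ellipse_with c' e f a b E"
  obtains \<phi> where "sin \<phi> \<noteq> 0" "E = range (touching_curve \<phi>)"
    "a\<^sup>2 + b\<^sup>2 = u \<bullet> u + v \<bullet> v + 2 * cos \<phi> * (u \<bullet> v)" "a\<^sup>2 * b\<^sup>2 = (sin \<phi>)\<^sup>2 * gram_det u v"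
proof -
  have ab: "0 < b" "b \<le> a" and ef: "norm e = 1" "norm f = 1" "e \<bullet> f = 0"
    and range: "E = range (ellipse_point c' e f a b)"
    using E by (auto simp: ellipse_with_def)
  define m n where "m = dual_vec u v" and "n = dual_vec v u"
  have gram_pos': "gram_det v u > 0" using gram_pos by (simp add: gram_det_commute)
  have mn: "m \<bullet> u = 1" "m \<bullet> v = 0" "n \<bullet> u = 0" "n \<bullet> v = 1"
    unfolding m_def n_def using dual_vec_inner[OF gram_pos] dual_vec_inner[OF gram_pos'] by simp_all
  have expand: "w = (m \<bullet> w) *\<^sub>R u + (n \<bullet> w) *\<^sub>R v" for w
    unfolding m_def n_def by (rule dual_vec_expansion[OF gram_pos])
  have hull: "E \<subseteq> convex hull {c - u - v, c + u - v, c + u + v, c - u + v}"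
    using ins by (simp add: inscribed_ellipse_def)
  have slab: "\<bar>k \<bullet> (x - c)\<bar> \<le> 1" if "x \<in> E" "k = m \<or> k = n" for x k
  proof -
    have "convex hull {c - u - v, c + u - v, c + u + v, c - u + v} \<subseteq> {x. \<bar>k \<bullet> (x - c)\<bar> \<le> 1}"
      using that(2) mn
      by (intro hull_minimal convex_slab) (auto simp: inner_diff_right inner_add_right)
    then show ?thesis using hull that(1) by blast
  qed
  have touch: "\<exists>x\<in>E. x \<in> closed_segment p q" if "tangent_to_segment E p q" for p q
    using that unfolding tangent_to_segment_def ellipse_with_def by blast
  have seg: "k \<bullet> (x - c) = k \<bullet> (p - c)" if x: "x \<in> closed_segment p q" and k: "k \<bullet> q = k \<bullet> p" for k p q x
  proof -
    obtain l where "x = (1 - l) *\<^sub>R p + l *\<^sub>R q" using x by (auto simp: in_segment)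
    then have "k \<bullet> x = (1 - l) * (k \<bullet> p) + l * (k \<bullet> p)" using k by (simp add: inner_add_right)
    then show ?thesis by (simp add: inner_diff_right algebra_simps)
  qed
  have on_side: "\<exists>x\<in>E. k \<bullet> (x - c) = k \<bullet> (p - c)"
    if "tangent_to_segment E p q" "k \<bullet> q = k \<bullet> p" for k p q
    using touch[OF that(1)] seg[OF _ that(2)] by blast
  have sides: "tangent_to_segment E (c - u - v) (c + u - v)" "tangent_to_segment E (c + u - v) (c + u + v)"
     "tangent_to_segment E (c + u + v) (c - u + v)" "tangent_to_segment E (c - u + v) (c - u - v)"
    using ins by (simp_all add: inscribed_ellipse_def)
  \<comment> \<open>The functional \<open>m\<close> is 1 and -1 on the second and fourth side,
    \<open>n\<close> is 1 and -1 on the third and first.\<close>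
  obtain x1 where x1: "x1 \<in> E" "m \<bullet> (x1 - c) = 1"
    using on_side[OF sides(2), of m] mn by (auto simp: inner_diff_right inner_add_right)
  obtain x2 where x2: "x2 \<in> E" "m \<bullet> (x2 - c) = -1"
    using on_side[OF sides(4), of m] mn by (auto simp: inner_diff_right inner_add_right)
  obtain y1 where y1: "y1 \<in> E" "n \<bullet> (y1 - c) = 1"
    using on_side[OF sides(3), of n] mn by (auto simp: inner_diff_right inner_add_right)
  obtain y2 where y2: "y2 \<in> E" "n \<bullet> (y2 - c) = -1"
    using on_side[OF sides(1), of n] mn by (auto simp: inner_diff_right inner_add_right)
  obtain \<theta> where \<theta>: "m \<bullet> c' = m \<bullet> c" "m \<bullet> (a *\<^sub>R e) = cos \<theta>" "m \<bullet> (b *\<^sub>R f) = sin \<theta>"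
    using ellipse_touching_slab[OF E slab x1 x2] by blast
  obtain \<psi> where \<psi>: "n \<bullet> c' = n \<bullet> c" "n \<bullet> (a *\<^sub>R e) = cos \<psi>" "n \<bullet> (b *\<^sub>R f) = sin \<psi>"
    using ellipse_touching_slab[OF E slab y1 y2] by blast
  have c': "c' = c" using expand[of c'] expand[of c] \<theta>(1) \<psi>(1) by simp
  have ae: "a *\<^sub>R e = cos \<theta> *\<^sub>R u + cos \<psi> *\<^sub>R v"
    using expand[of "a *\<^sub>R e"] unfolding \<theta> \<psi> .
  have bf: "b *\<^sub>R f = sin \<theta> *\<^sub>R u + sin \<psi> *\<^sub>R v"
    using expand[of "b *\<^sub>R f"] unfolding \<theta> \<psi> .
  \<comment> \<open>The two coordinates along the ellipse are \<open>cos (t - \<theta>)\<close> and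
    \<open>cos (t - \<psi>)\<close>; only their phase difference affects the curve.\<close>
  define \<phi> where "\<phi> = \<psi> - \<theta>"
  have pt: "touching_curve \<phi> (t - \<theta>) = ellipse_point c' e f a b t" for t
  proof -
    have "t - \<theta> - \<phi> = t - \<psi>" by (simp add: \<phi>_def)
    then show ?thesis
      unfolding ellipse_point_conj_curve ae bf c' touching_curve_def conj_curve_def
      by (simp add: cos_diff algebra_simps)
  qed
  have "E = range (touching_curve \<phi>)"
    unfolding range pt[symmetric] using range_shift[of "touching_curve \<phi>" "- \<theta>"] by simp
  moreover have "a\<^sup>2 + b\<^sup>2 = u \<bullet> u + v \<bullet> v + 2 * cos \<phi> * (u \<bullet> v)"
  proof -
    have "a\<^sup>2 + b\<^sup>2 = (a *\<^sub>R e) \<bullet> (a *\<^sub>R e) + (b *\<^sub>R f) \<bullet> (b *\<^sub>R f)"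
      using ef by (simp add: norm_eq_1 power2_eq_square)
    also have "\<dots> = ((cos \<theta>)\<^sup>2 + (sin \<theta>)\<^sup>2) * (u \<bullet> u) + ((cos \<psi>)\<^sup>2 + (sin \<psi>)\<^sup>2) * (v \<bullet> v)
        + 2 * (cos \<psi> * cos \<theta> + sin \<psi> * sin \<theta>) * (u \<bullet> v)"
      unfolding ae bf inner_add inner_scaleR_left inner_scaleR_right inner_commute[of v u]
        power2_eq_square distrib_left distrib_right by simp
    finally show ?thesis by (simp add: \<phi>_def cos_diff)
  qed
  moreover have det: "a\<^sup>2 * b\<^sup>2 = (sin \<phi>)\<^sup>2 * gram_det u v"
  proof -
    have "a\<^sup>2 * b\<^sup>2 = gram_det (a *\<^sub>R e) (b *\<^sub>R f)"
      unfolding gram_det_scaleR using ef by (simp add: gram_det_def norm_eq_1)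
    also have "\<dots> = (sin \<phi>)\<^sup>2 * gram_det u v"
      unfolding ae bf gram_det_comb \<phi>_def sin_diff by (simp add: mult.commute)
    finally show ?thesis .
  qed
  moreover have "sin \<phi> \<noteq> 0" using det ab by auto
  ultimately show ?thesis using that by blast
qed

lemma inscribed_touching_curve:
  assumes "sin \<phi> \<noteq> 0"
  obtains e f a b where "inscribed (range (touching_curve \<phi>))"
    "ellipse_with c e f a b (range (touching_curve \<phi>))"
    "a\<^sup>2 + b\<^sup>2 = u \<bullet> u + v \<bullet> v + 2 * cos \<phi> * (u \<bullet> v)" "a\<^sup>2 * b\<^sup>2 = (sin \<phi>)\<^sup>2 * gram_det u v"
proof -
  \<comment> \<open>Expanding \<open>cos (t - \<phi>)\<close> exhibits \<open>w\<close> and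
    \<open>z\<close> as conjugate half-diameters of the touching curve.\<close>
  define w where "w = u + cos \<phi> *\<^sub>R v"
  define z where "z = sin \<phi> *\<^sub>R v"
  have curve: "conj_curve c w z = touching_curve \<phi>"
    by (simp add: fun_eq_iff conj_curve_def touching_curve_def w_def z_def cos_diff algebra_simps)
  have det: "gram_det w z = (sin \<phi>)\<^sup>2 * gram_det u v"
    using gram_det_comb[of 1 u "cos \<phi>" v 0 "sin \<phi>"] by (simp add: w_def z_def)
  then have "gram_det w z > 0" using assms gram_pos by simp
  from principal_axes[OF this, of c] obtain e f a b \<theta> where
    E: "ellipse_with c e f a b (range (touching_curve \<phi>))" and
    pt: "\<And>t. ellipse_point c e f a b t = touching_curve \<phi> (t + \<theta>)" and
    sum: "a\<^sup>2 + b\<^sup>2 = w \<bullet> w + z \<bullet> z" and prod: "a\<^sup>2 * b\<^sup>2 = gram_det w z"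
    unfolding curve by blast
  have "w \<bullet> w + z \<bullet> z = u \<bullet> u + ((cos \<phi>)\<^sup>2 + (sin \<phi>)\<^sup>2) * (v \<bullet> v) + 2 * cos \<phi> * (u \<bullet> v)"
    unfolding w_def z_def inner_add inner_scaleR_left inner_scaleR_right inner_commute[of v u]
      power2_eq_square distrib_left distrib_right by simp
  with sum have sum: "a\<^sup>2 + b\<^sup>2 = u \<bullet> u + v \<bullet> v + 2 * cos \<phi> * (u \<bullet> v)" by simp
  have tangent: "tangent_to_segment (range (touching_curve \<phi>)) (p - d) (p + d)"
    if t: "touching_curve \<phi> t = p + l *\<^sub>R d" "\<bar>l\<bar> \<le> 1"
      and k: "- sin t *\<^sub>R u - sin (t - \<phi>) *\<^sub>R v = k *\<^sub>R d" for t p d k l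
  proof -
    have "((\<lambda>x. c + cos (x + \<theta>) *\<^sub>R u + cos (x + \<theta> - \<phi>) *\<^sub>R v) has_vector_derivative
        - sin t *\<^sub>R u - sin (t - \<phi>) *\<^sub>R v) (at (t - \<theta>))"
      by (auto intro!: derivative_eq_intros simp: has_real_derivative_iff_has_vector_derivative[symmetric])
    then have "vector_derivative (ellipse_point c e f a b) (at (t - \<theta>)) = k *\<^sub>R d"
      unfolding k pt[abs_def] touching_curve_def by (rule vector_derivative_at)
    also have "\<dots> = (k / 2) *\<^sub>R (p + d - (p - d))" by (simp add: vec_eq_iff)
    finally have "vector_derivative (ellipse_point c e f a b) (at (t - \<theta>)) = (k / 2) *\<^sub>R (p + d - (p - d))" .
    moreover have "p + l *\<^sub>R d = (1 - (1 + l) / 2) *\<^sub>R (p - d) + ((1 + l) / 2) *\<^sub>R (p + d)"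
      by (simp add: vec_eq_iff field_simps)
    then have "p + l *\<^sub>R d \<in> closed_segment (p - d) (p + d)"
      unfolding in_segment using t(2) by (intro exI[of _ "(1 + l) / 2"]) auto
    then have "ellipse_point c e f a b (t - \<theta>) \<in> closed_segment (p - d) (p + d)"
      unfolding pt using t(1) by simp
    ultimately show ?thesis unfolding tangent_to_segment_def using E by blast
  qed
  \<comment> \<open>Contacts occur where \<open>cos t\<close> or \<open>cos (t - \<phi>)\<close> is
    1 or -1. Each side is given by its midpoint and half-vector; the last two run backwards, hence
    the double negations.\<close>
  have "tangent_to_segment (range (touching_curve \<phi>)) (c - v - u) (c - v + u)"
    by (rule tangent[of "\<phi> + pi" _ "- cos \<phi>" _ "sin \<phi>"]) (simp_all add: touching_curve_def)
  moreover have "tangent_to_segment (range (touching_curve \<phi>)) (c + u - v) (c + u + v)"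
    by (rule tangent[of 0 _ "cos \<phi>" _ "sin \<phi>"]) (simp_all add: touching_curve_def)
  moreover have "tangent_to_segment (range (touching_curve \<phi>)) (c + v - - u) (c + v + - u)"
    by (rule tangent[of \<phi> _ "- cos \<phi>" _ "sin \<phi>"]) (simp_all add: touching_curve_def)
  moreover have "tangent_to_segment (range (touching_curve \<phi>)) (c - u - - v) (c - u + - v)"
    by (rule tangent[of pi _ "cos \<phi>" _ "sin \<phi>"]) (simp_all add: touching_curve_def)
  moreover have "range (touching_curve \<phi>) \<subseteq> convex hull {c - u - v, c + u - v, c + u + v, c - u + v}"
    unfolding touching_curve_def by (auto intro!: mem_parallelogram_hull)
  moreover have "ellipse (range (touching_curve \<phi>))" using E unfolding ellipse_def by blast
  ultimately have "inscribed (range (touching_curve \<phi>))"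
    by (simp add: inscribed_ellipse_def algebra_simps)
  then show ?thesis using that E sum prod det by simp
qed

section \<open>Minimal eccentricity and the diagonals\<close>

lemma diagonal_products_pos: "(u \<bullet> u + v \<bullet> v)\<^sup>2 - (2 * (u \<bullet> v))\<^sup>2 > 0"
proof -
  have "(u \<bullet> u + v \<bullet> v)\<^sup>2 - (2 * (u \<bullet> v))\<^sup>2 = (u \<bullet> u - v \<bullet> v)\<^sup>2 + 4 * gram_det u v"
    by (simp add: gram_det_def power2_eq_square algebra_simps)
  then show ?thesis using gram_pos zero_le_power2[of "u \<bullet> u - v \<bullet> v"] by linarith
qed

lemma min_ecc_ellipse_axes:
  obtains e f a b where
    "ellipse_with c e f a b (min_ecc_ellipse (c - u - v) (c + u - v) (c + u + v) (c - u + v))"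
    "((a\<^sup>2 - b\<^sup>2) / (a\<^sup>2 + b\<^sup>2))\<^sup>2
      = (u \<bullet> u - v \<bullet> v)\<^sup>2 / ((u \<bullet> u + v \<bullet> v)\<^sup>2 - (2 * (u \<bullet> v))\<^sup>2)"
proof -
  \<comment> \<open>This \<open>Q\<close> includes the factor 2, so the optimality condition reads
    \<open>P * cos \<phi> = - Q\<close>.\<close>
  define P Q G where "P = u \<bullet> u + v \<bullet> v" and "Q = 2 * (u \<bullet> v)" and "G = gram_det u v"
  have G: "G > 0" using gram_pos by (simp add: G_def)
  \<comment> \<open>\<open>K\<close> is the product of the squared half-diagonals,
    \<open>|u + v|^2 * |u - v|^2\<close>.\<close>
  define K where "K = P\<^sup>2 - Q\<^sup>2"
  have K: "K > 0" using diagonal_products_pos by (simp add: K_def P_def Q_def)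
  have "u \<noteq> 0" using gram_pos by (auto simp: gram_det_def)
  then have P: "P > 0" unfolding P_def by (simp add: add_pos_nonneg)
  have "Q\<^sup>2 < P\<^sup>2" using K by (simp add: K_def)
  then have "\<bar>Q\<bar> < P" using P by (metis abs_of_pos abs_square_less_1 power2_less_imp_less power2_abs less_imp_le)
  then have ran: "- 1 < - Q / P" "- Q / P < 1" using P by (simp_all add: field_simps)
  define \<phi>\<^sub>0 where "\<phi>\<^sub>0 = arccos (- Q / P)"
  have cos0: "cos \<phi>\<^sub>0 = - Q / P" using ran by (simp add: \<phi>\<^sub>0_def)
  have sin0: "(sin \<phi>\<^sub>0)\<^sup>2 = K / P\<^sup>2"
    unfolding sin_squared_eq cos0 K_def using P by (simp add: power_divide field_simps)
  then have "sin \<phi>\<^sub>0 \<noteq> 0" using K P by auto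
  then obtain e f a b where ins: "inscribed (range (touching_curve \<phi>\<^sub>0))"
    and E0: "ellipse_with c e f a b (range (touching_curve \<phi>\<^sub>0))"
    and sum: "a\<^sup>2 + b\<^sup>2 = P + cos \<phi>\<^sub>0 * Q" and prod: "a\<^sup>2 * b\<^sup>2 = (sin \<phi>\<^sub>0)\<^sup>2 * G"
    unfolding P_def Q_def G_def by (rule inscribed_touching_curve) (simp_all add: mult_ac)
  have sum: "a\<^sup>2 + b\<^sup>2 = K / P" unfolding sum cos0 K_def using P
    by (simp add: field_simps power2_eq_square)
  have prod: "a\<^sup>2 * b\<^sup>2 = K / P\<^sup>2 * G" unfolding prod sin0 ..
  \<comment> \<open>Assuming only a non-strict inequality serves twice: it shows that nothing is
    strictly better and that no other minimiser exists.\<close>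
  have unique: "E = range (touching_curve \<phi>\<^sub>0)"
    if insE: "inscribed E" and le: "eccentricity E \<le> eccentricity (range (touching_curve \<phi>\<^sub>0))" for E
  proof -
    obtain c' e' f' a' b' where E: "ellipse_with c' e' f' a' b' E"
      using insE by (auto simp: inscribed_ellipse_def ellipse_def)
    obtain \<phi> where \<phi>: "E = range (touching_curve \<phi>)"
      "a'\<^sup>2 + b'\<^sup>2 = P + cos \<phi> * Q" "a'\<^sup>2 * b'\<^sup>2 = (sin \<phi>)\<^sup>2 * G"
      unfolding P_def Q_def G_def
      by (rule inscribed_imp_touching_curve[OF insE E]) (simp add: mult_ac)
    have "K / P\<^sup>2 * G * (P + cos \<phi> * Q)\<^sup>2 \<le> (sin \<phi>)\<^sup>2 * G * (K / P)\<^sup>2"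
      using iffD1[OF eccentricity_le_iff[OF E0 E] le] unfolding \<phi>(2,3) sum prod .
    then have "(K * G / P\<^sup>2) * (P + cos \<phi> * Q)\<^sup>2 \<le> (K * G / P\<^sup>2) * ((sin \<phi>)\<^sup>2 * K)"
      by (simp add: power_divide power2_eq_square[of K] mult_ac)
    moreover have "K * G / P\<^sup>2 > 0" using K G P by simp
    ultimately have "(P + cos \<phi> * Q)\<^sup>2 \<le> (sin \<phi>)\<^sup>2 * K"
      by (rule mult_left_le_imp_le)
    \<comment> \<open>Minimality of the eccentricity at \<open>\<phi>\<^sub>0\<close> amounts to this square being nonnegative.\<close>
    then have "(Q + cos \<phi> * P)\<^sup>2 \<le> 0"
      unfolding sin_squared_eq K_def by (simp add: power2_eq_square algebra_simps)
    then have "cos \<phi> = - Q / P" using P by (simp add: field_simps)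
    then show ?thesis unfolding \<phi>(1) by (intro range_touching_curve_cong) (simp add: cos0)
  qed
  have least: "\<not> eccentricity E < eccentricity (range (touching_curve \<phi>\<^sub>0))" if "inscribed E" for E
    using unique[OF that] by force
  have "min_ecc_ellipse (c - u - v) (c + u - v) (c + u + v) (c - u + v) = range (touching_curve \<phi>\<^sub>0)"
    unfolding min_ecc_ellipse_def is_arg_min_def
  proof (rule the_equality)
    fix E assume E: "inscribed E \<and> (\<nexists>E'. inscribed E' \<and> eccentricity E' < eccentricity E)"
    then have "eccentricity E \<le> eccentricity (range (touching_curve \<phi>\<^sub>0))"
      using ins by (auto simp: not_less)
    then show "E = range (touching_curve \<phi>\<^sub>0)" using E unique by blast
  qed (use ins least in blast)
  moreover have "((a\<^sup>2 - b\<^sup>2) / (a\<^sup>2 + b\<^sup>2))\<^sup>2 = (u \<bullet> u - v \<bullet> v)\<^sup>2 / K"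
  proof -
    \<comment> \<open>The squared difference is the discriminant of the quadratic with roots
      \<open>a^2\<close> and \<open>b^2\<close>.\<close>
    have "(a\<^sup>2 - b\<^sup>2)\<^sup>2 = (a\<^sup>2 + b\<^sup>2)\<^sup>2 - 4 * (a\<^sup>2 * b\<^sup>2)"
      by (simp add: power2_diff power2_sum)
    also have "\<dots> = (K / P\<^sup>2) * (K - 4 * G)"
      unfolding sum prod by (simp add: power_divide power2_eq_square[of K] right_diff_distrib)
    also have "K - 4 * G = (u \<bullet> u - v \<bullet> v)\<^sup>2"
      unfolding K_def P_def Q_def G_def gram_det_def by (simp add: power2_eq_square algebra_simps)
    finally show ?thesis
      unfolding power_divide sum using K P by (simp add: field_simps power2_eq_square[of K])
  qed
  ultimately show ?thesis using that E0 unfolding K_def P_def Q_def by simp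
qed

text \<open>The half-diagonals \<open>u + v\<close> and \<open>u - v\<close> have inner product
  \<open>|u|^2 - |v|^2\<close>. The root of a square replaces its absolute value to match
  \<open>min_ecc_ellipse_axes\<close>.\<close>

lemma segment_angle_diagonals:
  "segment_angle (c - u - v) (c + u + v) (c + u - v) (c - u + v)
    = arccos (sqrt ((u \<bullet> u - v \<bullet> v)\<^sup>2 / ((u \<bullet> u + v \<bullet> v)\<^sup>2 - (2 * (u \<bullet> v))\<^sup>2)))"
proof -
  define d\<^sub>1 d\<^sub>2 where "d\<^sub>1 = u + v" and "d\<^sub>2 = u - v"
  have v: "c + u + v - (c - u - v) = 2 *\<^sub>R d\<^sub>1" "c - u + v - (c + u - v) = (- 2) *\<^sub>R d\<^sub>2"
    unfolding d\<^sub>1_def d\<^sub>2_def by (simp_all add: vec_eq_iff)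
  have "norm d\<^sub>1 * norm d\<^sub>2 = sqrt ((d\<^sub>1 \<bullet> d\<^sub>1) * (d\<^sub>2 \<bullet> d\<^sub>2))"
    by (simp add: norm_eq_sqrt_inner real_sqrt_mult)
  also have "(d\<^sub>1 \<bullet> d\<^sub>1) * (d\<^sub>2 \<bullet> d\<^sub>2) = (u \<bullet> u + v \<bullet> v)\<^sup>2 - (2 * (u \<bullet> v))\<^sup>2"
    unfolding d\<^sub>1_def d\<^sub>2_def
    by (simp add: inner_add inner_diff inner_commute[of v u] power2_eq_square algebra_simps)
  finally have den: "norm d\<^sub>1 * norm d\<^sub>2 = sqrt ((u \<bullet> u + v \<bullet> v)\<^sup>2 - (2 * (u \<bullet> v))\<^sup>2)" .
  have num: "d\<^sub>1 \<bullet> d\<^sub>2 = u \<bullet> u - v \<bullet> v"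
    unfolding d\<^sub>1_def d\<^sub>2_def by (simp add: inner_add inner_diff inner_commute)
  have "segment_angle (c - u - v) (c + u + v) (c + u - v) (c - u + v)
      = arccos (4 * \<bar>d\<^sub>1 \<bullet> d\<^sub>2\<bar> / (4 * (norm d\<^sub>1 * norm d\<^sub>2)))"
    unfolding segment_angle_def v by (simp add: abs_mult)
  then show ?thesis unfolding num den by (simp add: real_sqrt_divide)
qed

end

theorem theorem1:
  fixes A B C D :: "real^2" and p q r s :: "real^2"
  assumes "parallelogram A B C D"
    and "equal_conjugate_diameters (min_ecc_ellipse A B C D) p q r s"
  shows "segment_angle p q r s = segment_angle A C B D"
proof -
  define c u v where "c = midpoint A C" and "u = (1 / 2) *\<^sub>R (B - A)" and "v = (1 / 2) *\<^sub>R (C - B)"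
  have "D = A + C - B" using assms(1) by (simp add: parallelogram_def algebra_simps)
  then have vertices: "A = c - u - v" "B = c + u - v" "C = c + u + v" "D = c - u + v"
    by (simp_all add: c_def u_def v_def midpoint_def vec_eq_iff field_simps)
  \<comment> \<open>Based at \<open>B\<close>, the adjacent sides are \<open>-2 u\<close> and
    \<open>2 v\<close>.\<close>
  have "\<not> collinear {0, A - B, C - B}"
    using assms(1) by (simp add: parallelogram_def collinear_3)
  then have "gram_det ((- 2) *\<^sub>R u) (2 *\<^sub>R v) > 0"
    unfolding gram_det_pos_iff by (simp add: u_def v_def)
  then have "gram_det u v > 0" unfolding gram_det_scaleR by simp
  then interpret nondegenerate_parallelogram c u v by unfold_locales
  obtain e f a b where E: "ellipse_with c e f a b (min_ecc_ellipse A B C D)"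
    and sq: "((a\<^sup>2 - b\<^sup>2) / (a\<^sup>2 + b\<^sup>2))\<^sup>2
      = (u \<bullet> u - v \<bullet> v)\<^sup>2 / ((u \<bullet> u + v \<bullet> v)\<^sup>2 - (2 * (u \<bullet> v))\<^sup>2)"
    unfolding vertices by (rule min_ecc_ellipse_axes)
  \<comment> \<open>The squared cosines agree; nonnegativity allows taking roots.\<close>
  have "b\<^sup>2 \<le> a\<^sup>2" using E by (auto simp: ellipse_with_def intro: power_mono)
  then have "0 \<le> (a\<^sup>2 - b\<^sup>2) / (a\<^sup>2 + b\<^sup>2)" by simp
  then have "(a\<^sup>2 - b\<^sup>2) / (a\<^sup>2 + b\<^sup>2)
      = sqrt ((u \<bullet> u - v \<bullet> v)\<^sup>2 / ((u \<bullet> u + v \<bullet> v)\<^sup>2 - (2 * (u \<bullet> v))\<^sup>2))"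
    using sq by (metis real_sqrt_unique)
  then show ?thesis
    using equal_conjugate_diameters_angle[OF E assms(2)] segment_angle_diagonals
    unfolding vertices by simp
qed

end
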